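(* Let $a,b$ be integers with $a+b\ge 2$. If the truncated affine arrangement $\mathcal{A}^{a,b}_{n-1}$ satisfies $a,b\ge 0$, then a valid associated weighted digraph is $m$-acyclic if and only if it contains no $m$-ascending cycle of length at most four.
   Context: For integers $a,b$ with $a+b\ge 2$, the truncated affine arrangement $\mathcal{A}^{a,b}_{n-1}$ consists of the hyperplanes $x_i-x_j=1-a,2-a,\ldots,b-1$, $1\le i<j\le n$, in $V_{n-1}=\{x\in\mathbb{R}^n: x_1+\cdots+x_n=0\}$. A weighted digraph on $\{1,\ldots,n\}$ is a valid weighted digraph associated to $\mathcal{A}^{a,b}_{n-1}$ if for each $i<j$ exactly one of the following holds: (1) there is no edge $i\rightarrow j$ and there is exactly one edge $j\rightarrow i$, of weight $a-1$; (2) there is exactly one edge $i\rightarrow j$, of weight $w$, and exactly one edge $j\rightarrow i$, of weight $-w-1$, for some integer $w$ with $1-a\le w\le b-2$; (3) there is exactly one edge $i\rightarrow j$, of weight $b-1$, and there is no edge $j\rightarrow i$. An $m$-ascending cycle is a directed cycle whose total weight is nonnegative; a weighted digraph is $m$-acyclic if it contains no $m$-ascending cycle. The length of a cycle is its number of edges. *)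

theory Defs
  imports "Graph_Theory.Weighted_Graph"
begin

definition edges_from_to :: "('v, 'e) pre_digraph \<Rightarrow> 'v \<Rightarrow> 'v \<Rightarrow> 'e set" where
  "edges_from_to G i j = {e \<in> arcs G. tail G e = i \<and> head G e = j}"

definition no_edge :: "('v, 'e) pre_digraph \<Rightarrow> 'v \<Rightarrow> 'v \<Rightarrow> bool" where
  "no_edge G i j \<longleftrightarrow> edges_from_to G i j = {}"

definition single_edge ::
  "('v, 'e) pre_digraph \<Rightarrow> 'e weight_fun \<Rightarrow> 'v \<Rightarrow> 'v \<Rightarrow> int \<Rightarrow> bool" where
  "single_edge G weight i j w \<longleftrightarrow>
     (\<exists>e. edges_from_to G i j = {e} \<and> weight e = real_of_int w)"

definition only_backward ::
  "int \<Rightarrow> ('v, 'e) pre_digraph \<Rightarrow> 'e weight_fun \<Rightarrow> 'v \<Rightarrow> 'v \<Rightarrow> bool" where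
  "only_backward a G weight i j \<longleftrightarrow> no_edge G i j \<and> single_edge G weight j i (a - 1)"

definition both_directions ::
  "int \<Rightarrow> int \<Rightarrow> ('v, 'e) pre_digraph \<Rightarrow> 'e weight_fun \<Rightarrow> 'v \<Rightarrow> 'v \<Rightarrow> bool" where
  "both_directions a b G weight i j \<longleftrightarrow>
     (\<exists>w. 1 - a \<le> w \<and> w \<le> b - 2 \<and>
        single_edge G weight i j w \<and> single_edge G weight j i (- w - 1))"

definition only_forward ::
  "int \<Rightarrow> ('v, 'e) pre_digraph \<Rightarrow> 'e weight_fun \<Rightarrow> 'v \<Rightarrow> 'v \<Rightarrow> bool" where
  "only_forward b G weight i j \<longleftrightarrow> single_edge G weight i j (b - 1) \<and> no_edge G j i"

(* The truncated affine arrangement with parameters a, b in V_(n-1), i.e. the hyperplanes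
   x_i - x_j = 1-a, 2-a, ..., b-1 for 1 <= i < j <= n, enters only through a, b and n.
   Only pairs of distinct vertices are constrained: loops are not excluded, so statements
   about valid weighted digraphs cover the loopless ones in particular. *)
definition valid_weighted_digraph ::
  "int \<Rightarrow> int \<Rightarrow> nat \<Rightarrow> (nat, 'e) pre_digraph \<Rightarrow> 'e weight_fun \<Rightarrow> bool" where
  "valid_weighted_digraph a b n G weight \<longleftrightarrow>
     wf_digraph G \<and> verts G = {1..n} \<and>
     (\<forall>i\<in>{1..n}. \<forall>j\<in>{1..n}. i < j \<longrightarrow>
        only_backward a G weight i j \<and> \<not> both_directions a b G weight i j
          \<and> \<not> only_forward b G weight i j
      \<or> \<not> only_backward a G weight i j \<and> both_directions a b G weight i j
          \<and> \<not> only_forward b G weight i j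
      \<or> \<not> only_backward a G weight i j \<and> \<not> both_directions a b G weight i j
          \<and> only_forward b G weight i j)"

(* A cycle is given by its list of arcs and does not repeat vertices. *)
definition m_ascending_cycle ::
  "('v, 'e) pre_digraph \<Rightarrow> 'e weight_fun \<Rightarrow> 'e awalk \<Rightarrow> bool" where
  "m_ascending_cycle G weight p \<longleftrightarrow>
     pre_digraph.cycle G p \<and> wf_digraph.awalk_cost weight p \<ge> 0"

definition m_acyclic :: "('v, 'e) pre_digraph \<Rightarrow> 'e weight_fun \<Rightarrow> bool" where
  "m_acyclic G weight \<longleftrightarrow> \<not> (\<exists>p. m_ascending_cycle G weight p)"

end

theory Submission
  imports Defs
begin

text \<open>
  Write \<open>D u v\<close> for the largest weight that the digraph allows on an edge \<open>u \<rightarrow> v\<close>, namely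
  \<open>b - 1\<close> if \<open>u < v\<close> and \<open>a - 1\<close> if \<open>u > v\<close>. Every edge \<open>u \<rightarrow> v\<close> between distinct vertices has
  an integral weight between \<open>- D v u\<close> and \<open>D u v\<close>, and for \<open>a, b \<ge> 0\<close> the function \<open>D\<close>
  satisfies the almost-triangle inequality \<open>D u v \<le> D u w + D w v + 1\<close>
  (\<open>max_weight_triangle\<close>). This is the only place where the signs of \<open>a\<close> and \<open>b\<close> matter.

  Take an ascending cycle \<open>v\<^sub>0, \<dots>, v\<^bsub>k-1\<^esub>\<close> of total weight \<open>S \<ge> 0\<close> and of minimal length, and
  suppose \<open>k \<ge> 5\<close>. A chord cuts the cycle into two shorter cycles, one for each direction in
  which the chord is traversed. Were both directions edges, their weights would add up to \<open>-1\<close>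
  and the two cycles to \<open>S - 1 \<ge> -1\<close>; by integrality one of them would be ascending, against
  minimality. So each chord has just one direction, carries its maximal weight, and the shorter
  cycle that it closes has weight at most \<open>-1\<close>. In terms of the weight \<open>P\<close> of the path
  from \<open>v\<^sub>i\<close> to \<open>v\<^sub>j\<close> with \<open>i < j\<close>, either the chord is a shortcut \<open>v\<^sub>i \<rightarrow> v\<^sub>j\<close> and
  \<open>P \<ge> S + D v\<^sub>i v\<^sub>j + 1\<close>, or it runs back and \<open>P \<le> - D v\<^sub>j v\<^sub>i - 1\<close>
  (\<open>chord_dichotomy\<close>).

  Now let \<open>w\<close> be a vertex not adjacent on the cycle to either end of a cycle edge \<open>x \<rightarrow> y\<close>.
  If one of the chords at \<open>w\<close> to \<open>x\<close> and \<open>y\<close> enters \<open>w\<close> and the other one leaves it, the two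
  inequalities leave for the weight of \<open>x \<rightarrow> y\<close> only values outside the interval from
  \<open>- D y x\<close> to \<open>D x y\<close>, by the triangle inequality. Hence both chords enter \<open>w\<close> or both leave it.
  Propagating this through the chords \<open>{0,2}, {0,3}, {1,3}, {1,4}, {2,4}, {2,5}, \<dots>, {2,k-1}\<close>
  and finally through the cycle edge from \<open>v\<^bsub>k-1\<^esub>\<close> to \<open>v\<^sub>0\<close> back to \<open>{0,2}\<close> shows that
  the chord \<open>{0,2}\<close> both leaves and enters \<open>v\<^sub>2\<close>
  (\<open>no_cycle_with_oriented_chords\<close>). For \<open>k = 4\<close> the argument breaks down because the pair
  \<open>{0,3}\<close> is then an edge of the cycle and not a chord.
\<close>

section \<open>Maximal edge weights\<close>

definition max_weight :: "int \<Rightarrow> int \<Rightarrow> nat \<Rightarrow> nat \<Rightarrow> real" where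
  "max_weight a b u v = real_of_int (if u < v then b - 1 else a - 1)"

text \<open>
  If \<open>w\<close> lies between \<open>u\<close> and \<open>v\<close>, the three values agree and the claim is that they are at
  least \<open>-1\<close>. Otherwise one step of the detour has the direction of the step from \<open>u\<close> to \<open>v\<close>,
  and the other one costs at least \<open>-1\<close>.
\<close>

lemma max_weight_triangle:
  assumes "a \<ge> 0" "b \<ge> 0" "u \<noteq> w" "w \<noteq> v"
  shows "max_weight a b u v \<le> max_weight a b u w + max_weight a b w v + 1"
  using assms by (auto simp: max_weight_def)

lemma valid_pair_cases:
  assumes "valid_weighted_digraph a b n G weight"
    and "u \<in> {1..n}" "v \<in> {1..n}" "u < v"
  obtains "only_backward a G weight u v"
    | "both_directions a b G weight u v"
    | "only_forward b G weight u v"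
  using assms unfolding valid_weighted_digraph_def by blast

lemma edges_from_to_arc:
  "e \<in> arcs G \<Longrightarrow> e \<in> edges_from_to G (tail G e) (head G e)"
  by (simp add: edges_from_to_def)

text \<open>
  If only one direction is present, its edge has the maximal weight for that direction, and
  \<open>a + b \<ge> 2\<close> is what keeps this maximum above the lower bound.
\<close>

lemma valid_weight_bounds:
  assumes ab: "a + b \<ge> 2"
    and valid: "valid_weighted_digraph a b n G weight"
    and e: "e \<in> arcs G" and ne: "tail G e \<noteq> head G e"
  shows "weight e \<in> \<int>"
    and "- max_weight a b (head G e) (tail G e) \<le> weight e"
    and "weight e \<le> max_weight a b (tail G e) (head G e)"
proof -
  let ?u = "tail G e" and ?v = "head G e"
  have wf: "wf_digraph G" and V: "verts G = {1..n}"
    using valid by (auto simp: valid_weighted_digraph_def)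
  have uv: "?u \<in> {1..n}" "?v \<in> {1..n}"
    using wf_digraph.tail_in_verts[OF wf e] wf_digraph.head_in_verts[OF wf e] V by auto
  have mem: "e \<in> edges_from_to G ?u ?v"
    using e by (rule edges_from_to_arc)
  have single: "weight e = of_int w" if "single_edge G weight ?u ?v w" for w
    using that mem by (auto simp: single_edge_def)
  have some: "\<not> no_edge G ?u ?v"
    using mem by (auto simp: no_edge_def)
  have "\<exists>w. weight e = of_int w \<and>
      (if ?u < ?v then 1 - a \<le> w \<and> w \<le> b - 1 else 1 - b \<le> w \<and> w \<le> a - 1)"
  proof (cases "?u < ?v")
    case True
    from valid uv True show ?thesis
    proof (cases rule: valid_pair_cases)
      case 1
      then show ?thesis using some by (simp add: only_backward_def)
    next
      case 2
      then obtain w where "1 - a \<le> w" "w \<le> b - 2" "single_edge G weight ?u ?v w"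
        by (auto simp: both_directions_def)
      then show ?thesis using single True by (intro exI[of _ w]) auto
    next
      case 3
      then show ?thesis using single True ab
        by (intro exI[of _ "b - 1"]) (auto simp: only_forward_def)
    qed
  next
    case False
    then have "?v < ?u" using ne by simp
    from valid uv(2,1) this show ?thesis
    proof (cases rule: valid_pair_cases)
      case 1
      then show ?thesis using single False ab
        by (intro exI[of _ "a - 1"]) (auto simp: only_backward_def)
    next
      case 2
      then obtain w where "1 - a \<le> w" "w \<le> b - 2" "single_edge G weight ?u ?v (- w - 1)"
        by (auto simp: both_directions_def)
      then show ?thesis using single False by (intro exI[of _ "- w - 1"]) auto
    next
      case 3
      then show ?thesis using some by (simp add: only_forward_def)
    qed
  qed
  then obtain w where w: "weight e = of_int w"
    and bounds: "if ?u < ?v then 1 - a \<le> w \<and> w \<le> b - 1 else 1 - b \<le> w \<and> w \<le> a - 1"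
    by blast
  show "weight e \<in> \<int>" using w by simp
  show "- max_weight a b ?v ?u \<le> weight e" "weight e \<le> max_weight a b ?u ?v"
    using w bounds ne by (auto simp: max_weight_def split: if_splits)
qed

text \<open>
  The definition of validity distinguishes the smaller vertex of a pair. The chords of a cycle
  come in the order of the cycle, so the three cases are needed for \<open>u\<close> and \<open>v\<close> in either order.
\<close>

lemma valid_edge_cases:
  assumes valid: "valid_weighted_digraph a b n G weight"
    and uv: "u \<in> {1..n}" "v \<in> {1..n}" "u \<noteq> v"
  obtains
    (mutual) e f where "e \<in> arcs G" "tail G e = u" "head G e = v"
      "f \<in> arcs G" "tail G f = v" "head G f = u" "weight e + weight f = -1"
  | (direct) e where "e \<in> arcs G" "tail G e = u" "head G e = v" "weight e = max_weight a b u v"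
  | (reverse) f where "f \<in> arcs G" "tail G f = v" "head G f = u" "weight f = max_weight a b v u"
proof -
  have arc: "\<exists>e \<in> arcs G. tail G e = x \<and> head G e = y \<and> weight e = of_int w"
    if "single_edge G weight x y w" for x y w
    using that by (auto simp: single_edge_def edges_from_to_def)
  have two: "\<exists>e\<in>arcs G. \<exists>f\<in>arcs G. tail G e = x \<and> head G e = y \<and>
      tail G f = y \<and> head G f = x \<and> weight e + weight f = -1"
    if "both_directions a b G weight x y" for x y
  proof -
    from that obtain w where "single_edge G weight x y w" "single_edge G weight y x (- w - 1)"
      by (auto simp: both_directions_def)
    then show ?thesis using arc[of x y w] arc[of y x "- w - 1"] by fastforce
  qed
  show thesis
  proof (cases "u < v")
    case True
    from valid uv(1,2) True show thesis
    proof (cases rule: valid_pair_cases)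
      case 1
      then obtain e where "e \<in> arcs G" "tail G e = v" "head G e = u"
          "weight e = of_int (a - 1)"
        using arc[of v u "a - 1"] by (auto simp: only_backward_def)
      then show thesis using reverse[of e] \<open>u < v\<close> by (simp add: max_weight_def)
    next
      case 2
      then obtain e f where "e \<in> arcs G" "f \<in> arcs G" "tail G e = u" "head G e = v"
          "tail G f = v" "head G f = u" "weight e + weight f = -1"
        using two by blast
      then show thesis using mutual[of e f] by simp
    next
      case 3
      then obtain e where "e \<in> arcs G" "tail G e = u" "head G e = v"
          "weight e = of_int (b - 1)"
        using arc[of u v "b - 1"] by (auto simp: only_forward_def)
      then show thesis using direct[of e] \<open>u < v\<close> by (simp add: max_weight_def)
    qed
  next
    case False
    then have "v < u" using uv by simp
    from valid uv(2,1) this show thesis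
    proof (cases rule: valid_pair_cases)
      case 1
      then obtain e where "e \<in> arcs G" "tail G e = u" "head G e = v"
          "weight e = of_int (a - 1)"
        using arc[of u v "a - 1"] by (auto simp: only_backward_def)
      then show thesis using direct[of e] \<open>v < u\<close> by (simp add: max_weight_def)
    next
      case 2
      then obtain e f where "e \<in> arcs G" "f \<in> arcs G" "tail G e = v" "head G e = u"
          "tail G f = u" "head G f = v" "weight e + weight f = -1"
        using two by blast
      then show thesis using mutual[of f e] by simp
    next
      case 3
      then obtain e where "e \<in> arcs G" "tail G e = v" "head G e = u"
          "weight e = of_int (b - 1)"
        using arc[of v u "b - 1"] by (auto simp: only_forward_def)
      then show thesis using reverse[of e] \<open>v < u\<close> by (simp add: max_weight_def)
    qed
  qed
qed

section \<open>Cutting a cycle along a chord\<close>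

context wf_digraph
begin

text \<open>
  The library asks for distinct heads. Tails are what \<open>take\<close> and \<open>drop\<close> act on conveniently: if
  \<open>tail G (p ! i)\<close> is the \<open>i\<close>-th vertex, then \<open>take i p\<close> ends there and \<open>drop i p\<close> starts there.
\<close>

lemma cycle_iff_distinct_tails:
  "cycle p \<longleftrightarrow> p \<noteq> [] \<and> (\<exists>u. awalk u p u) \<and> distinct (map (tail G) p)"
proof -
  have "distinct (tl (awalk_verts u p)) \<longleftrightarrow> distinct (map (tail G) p)"
    if "awalk u p u" "p \<noteq> []" for u
  proof -
    have "cas u p u" using that by auto
    then have "map (tail G) p @ [head G (last p)] = tail G (hd p) # map (head G) p"
      using awalk_verts_conv[of u p] awalk_verts_conv'[of u p u] that by simp
    moreover have ends: "tail G (hd p) = u" "head G (last p) = u"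
      using that \<open>cas u p u\<close> awlast_if_cas[of u p u] by (auto simp: cas_simp awalk_verts_conv)
    ultimately have closed: "map (tail G) p @ [u] = u # map (head G) p"
      by simp
    have "u \<in> set (map (tail G) p)" "u \<in> set (map (head G) p)"
      using ends that(2) by (metis hd_in_set last_in_set imageI set_map)+
    then have "set (map (tail G) p) = set (map (head G) p)"
      using arg_cong[OF closed, of set] by (simp add: insert_absorb)
    then have "distinct (map (tail G) p) \<longleftrightarrow> distinct (map (head G) p)"
      by (metis card_distinct distinct_card length_map)
    then show ?thesis
      using awalk_verts_conv'[OF \<open>cas u p u\<close>] that by simp
  qed
  then show ?thesis unfolding cycle_def by auto
qed

lemma awalk_split_at:
  assumes "awalk u p v" "i < length p"
  shows "awalk u (take i p) (tail G (p ! i))" "awalk (tail G (p ! i)) (drop i p) v"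
proof -
  have "awalk u (take i p @ p ! i # drop (Suc i) p) v"
    using assms by (simp add: id_take_nth_drop[symmetric])
  then show "awalk u (take i p) (tail G (p ! i))" "awalk (tail G (p ! i)) (drop i p) v"
    using assms(2) by (auto simp: awalk_Cons_iff Cons_nth_drop_Suc[symmetric])
qed

lemma cycle_shortcut:
  assumes "cycle p" "i < j" "j < length p"
    and "e \<in> arcs G" "tail G e = tail G (p ! i)" "head G e = tail G (p ! j)"
  shows "cycle (take i p @ e # drop j p)"
proof -
  obtain u where u: "awalk u p u" and d: "distinct (map (tail G) p)"
    using assms(1) by (auto simp: cycle_iff_distinct_tails)
  have "awalk u (take i p @ e # drop j p) u"
    using awalk_split_at(1)[OF u, of i] awalk_split_at(2)[OF u, of j] assms
    by (intro awalk_appendI) (auto simp: awalk_Cons_iff)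
  moreover have "distinct (map (tail G) (take i p @ e # drop j p))"
  proof -
    let ?t = "map (tail G) p"
    have "map (tail G) (take i p @ e # drop j p) = take (Suc i) ?t @ drop j ?t"
      using assms by (simp add: take_Suc_conv_app_nth take_map drop_map)
    moreover have "distinct (take (Suc i) ?t @ drop j ?t)"
      using d assms(2) by (simp only: distinct_append distinct_take distinct_drop)
        (simp add: set_take_disj_set_drop_if_distinct)
    ultimately show ?thesis by simp
  qed
  ultimately show ?thesis by (auto simp: cycle_iff_distinct_tails)
qed

lemma cycle_close_back:
  assumes "cycle p" "i < j" "j < length p"
    and "f \<in> arcs G" "tail G f = tail G (p ! j)" "head G f = tail G (p ! i)"
  shows "cycle (drop i (take j p) @ [f])"
proof -
  obtain u where u: "awalk u p u" and d: "distinct (map (tail G) p)"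
    using assms(1) by (auto simp: cycle_iff_distinct_tails)
  have "awalk (tail G (p ! i)) (drop i (take j p)) (tail G (p ! j))"
    using awalk_split_at(2)[OF awalk_split_at(1)[OF u assms(3)], of i] assms by simp
  then have "awalk (tail G (p ! i)) (drop i (take j p) @ [f]) (tail G (p ! i))"
    using arc_implies_awalk[OF assms(4)] assms(5,6) by (intro awalk_appendI) auto
  moreover have "distinct (map (tail G) (drop i (take j p) @ [f]))"
  proof -
    let ?t = "map (tail G) p"
    have "map (tail G) (drop i (take j p) @ [f]) = drop i (take (Suc j) ?t)"
      using assms by (simp add: take_Suc_conv_app_nth take_map drop_map)
    moreover have "distinct (drop i (take (Suc j) ?t))"
      using d by simp
    ultimately show ?thesis by simp
  qed
  ultimately show ?thesis by (auto simp: cycle_iff_distinct_tails)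
qed

lemma cycle_step:
  assumes "cycle p" "Suc i < length p"
  shows "head G (p ! i) = tail G (p ! Suc i)"
proof -
  obtain u where u: "awalk u p u"
    using assms(1) by (auto simp: cycle_iff_distinct_tails)
  have "awalk (tail G (p ! i)) (drop i p) u"
    using awalk_split_at(2)[OF u, of i] assms(2) by simp
  then show ?thesis
    using assms(2) by (simp add: Cons_nth_drop_Suc[symmetric] awalk_Cons_iff)
qed

lemma cycle_last_step:
  assumes "cycle p"
  shows "head G (p ! (length p - 1)) = tail G (p ! 0)"
proof -
  obtain u where u: "awalk u p u" and ne: "p \<noteq> []"
    using assms(1) by (auto simp: cycle_iff_distinct_tails)
  have "awalk (tail G (p ! (length p - 1))) (drop (length p - 1) p) u"
    using awalk_split_at(2)[OF u, of "length p - 1"] ne by simp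
  then have "head G (p ! (length p - 1)) = u"
    using ne by (simp add: Cons_nth_drop_Suc[symmetric] awalk_simps)
  moreover have "tail G (p ! 0) = u"
    using u ne by (cases p) (auto simp: awalk_Cons_iff)
  ultimately show ?thesis by simp
qed

end

section \<open>Chords of a shortest ascending cycle\<close>

text \<open>
  No vertices or edges are left here: \<open>P i\<close> is the weight of the path from the first
  to the \<open>i\<close>-th vertex, \<open>S\<close> is the weight of the whole cycle, and a chord \<open>{i, j}\<close> with
  \<open>i < j\<close> is directed from \<open>i\<close> to \<open>j\<close> precisely if the first alternative of the dichotomy
  holds.
\<close>

lemma no_cycle_with_oriented_chords:
  fixes D :: "nat \<Rightarrow> nat \<Rightarrow> real" and P :: "nat \<Rightarrow> real" and S :: real
  assumes k: "k \<ge> 5" and S: "S \<ge> 0" and P0: "P 0 = 0"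
    and triangle: "\<And>i j l. \<lbrakk>i < k; j < k; l < k; i \<noteq> j; j \<noteq> l\<rbrakk> \<Longrightarrow> D i l \<le> D i j + D j l + 1"
    and step: "\<And>i. Suc i < k \<Longrightarrow> - D (Suc i) i \<le> P (Suc i) - P i \<and> P (Suc i) - P i \<le> D i (Suc i)"
    and close: "- D 0 (k - 1) \<le> S - P (k - 1)" "S - P (k - 1) \<le> D (k - 1) 0"
    and chord: "\<And>i j. \<lbrakk>i + 2 \<le> j; j < k; j - i < k - 1\<rbrakk> \<Longrightarrow>
      P j - P i \<ge> S + D i j + 1 \<or> P j - P i \<le> - D j i - 1"
  shows False
proof -
  define fwd where "fwd i j \<longleftrightarrow> P j - P i \<ge> S + D i j + 1" for i j
  have fwdD: "P j - P i \<ge> S + D i j + 1" if "fwd i j" for i j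
    using that by (simp add: fwd_def)
  have bwdD: "P j - P i \<le> - D j i - 1"
    if "\<not> fwd i j" "i + 2 \<le> j" "j < k" "j - i < k - 1" for i j
    using that chord[of i j] by (auto simp: fwd_def)
  \<comment> \<open>Compare the chords from a vertex to both ends of a cycle edge, which comes after the vertex
    here and before it in the next claim.\<close>
  have move_end: "fwd i j \<longleftrightarrow> fwd i (Suc j)"
    if "i + 2 \<le> j" "Suc j < k" "Suc j - i < k - 1" for i j
  proof (rule iffI; rule ccontr)
    assume "fwd i j" "\<not> fwd i (Suc j)"
    then show False
      using fwdD[of i j] bwdD[of i "Suc j"] step[of j] triangle[of "Suc j" i j] S that by force
  next
    assume "fwd i (Suc j)" "\<not> fwd i j"
    then show False
      using fwdD[of i "Suc j"] bwdD[of i j] step[of j] triangle[of j i "Suc j"] S that by force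
  qed
  have move_start: "fwd i j \<longleftrightarrow> fwd (Suc i) j"
    if "Suc i + 2 \<le> j" "j < k" "j - i < k - 1" for i j
  proof (rule iffI; rule ccontr)
    assume "fwd i j" "\<not> fwd (Suc i) j"
    then show False
      using fwdD[of i j] bwdD[of "Suc i" j] step[of i] triangle[of i j "Suc i"] S that by force
  next
    assume "fwd (Suc i) j" "\<not> fwd i j"
    then show False
      using fwdD[of "Suc i" j] bwdD[of i j] step[of i] triangle[of "Suc i" j i] S that by force
  qed
  have "fwd 0 2 \<longleftrightarrow> fwd 0 3"
    using move_end[of 0 2] k by (simp add: numeral_3_eq_3 numeral_2_eq_2)
  also have "\<dots> \<longleftrightarrow> fwd 1 3"
    using move_start[of 0 3] k by simp
  also have "\<dots> \<longleftrightarrow> fwd 1 4"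
    using move_end[of 1 3] k by simp
  also have "\<dots> \<longleftrightarrow> fwd 2 4"
    using move_start[of 1 4] k by (simp add: numeral_2_eq_2)
  also have "\<dots> \<longleftrightarrow> fwd 2 (k - 1)"
  proof -
    have "fwd 2 4 \<longleftrightarrow> fwd 2 j" if "4 \<le> j" "j < k" for j
      using that
    proof (induction j rule: dec_induct)
      case (step j)
      then show ?case using move_end[of 2 j] by simp
    qed simp
    then show ?thesis using k by simp
  qed
  finally have same: "fwd 0 2 \<longleftrightarrow> fwd 2 (k - 1)" .
  \<comment> \<open>The cycle edge from the last to the first vertex, seen from vertex 2, forces the opposite.\<close>
  show False
  proof (cases "fwd 0 2")
    case True
    then show False
      using same fwdD[of 0 2] fwdD[of 2 "k - 1"] close P0 S triangle[of 0 2 "k - 1"] k by force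
  next
    case False
    then show False
      using same bwdD[of 0 2] bwdD[of 2 "k - 1"] close P0 S triangle[of "k - 1" 2 0] k by force
  qed
qed

text \<open>
  In a cycle with at least two edges no edge is a loop, so its weight is integral. A negative
  weight is then at most \<open>-1\<close>, which is what makes the dichotomy below sharp.
\<close>

lemma cycle_arc_not_loop:
  assumes "wf_digraph G" "pre_digraph.cycle G p" "length p \<ge> 2" "e \<in> set p"
  shows "e \<in> arcs G" "tail G e \<noteq> head G e"
proof -
  interpret wf_digraph G by fact
  have d: "distinct (map (tail G) p)" and "set p \<subseteq> arcs G"
    using assms(2) by (auto simp: cycle_iff_distinct_tails)
  then show "e \<in> arcs G" using assms(4) by auto
  obtain i where i: "i < length p" "e = p ! i"
    using assms(4) by (auto simp: in_set_conv_nth)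
  have inj: "tail G (p ! k) \<noteq> tail G (p ! l)" if "k < length p" "l < length p" "k \<noteq> l" for k l
    using nth_eq_iff_index_eq[OF d, of k l] that by simp
  show "tail G e \<noteq> head G e"
  proof (cases "Suc i < length p")
    case True
    then show ?thesis
      using cycle_step[OF assms(2) True] inj[of i "Suc i"] i by simp
  next
    case False
    then have last: "i = length p - 1" using i by simp
    have "length p - 1 \<noteq> 0" using assms(3) by simp
    then show ?thesis
      unfolding i(2) last cycle_last_step[OF assms(2)] by (intro inj) (use assms(3) in auto)
  qed
qed

lemma cycle_cost_le_minus_one:
  assumes ab: "a + b \<ge> 2"
    and valid: "valid_weighted_digraph a b n G weight"
    and cyc: "pre_digraph.cycle G p" "length p \<ge> 2"
    and desc: "\<not> m_ascending_cycle G weight p"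
  shows "wf_digraph.awalk_cost weight p \<le> -1"
proof -
  interpret wf_digraph G using valid by (simp add: valid_weighted_digraph_def)
  have "awalk_cost weight p \<in> \<int>"
  proof -
    have "\<forall>e\<in>set p. weight e \<in> \<int>"
      by (intro ballI valid_weight_bounds(1)[OF ab valid] cycle_arc_not_loop[OF wf_digraph_axioms cyc])
    then show ?thesis by (induction p) auto
  qed
  then obtain c :: int where "awalk_cost weight p = of_int c"
    by (auto elim: Ints_cases)
  moreover have "awalk_cost weight p < 0"
    using desc cyc by (simp add: m_ascending_cycle_def)
  ultimately show ?thesis by simp
qed

lemma chord_dichotomy:
  fixes weight :: "'e weight_fun" and p :: "'e awalk"
  defines "cost \<equiv> wf_digraph.awalk_cost weight"
  assumes ab: "a + b \<ge> 2"
    and valid: "valid_weighted_digraph a b n G weight"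
    and p: "m_ascending_cycle G weight p"
    and minimal: "\<And>q. m_ascending_cycle G weight q \<Longrightarrow> length p \<le> length q"
    and ij: "i + 2 \<le> j" "j < length p" "j - i < length p - 1"
  shows "cost (take j p) - cost (take i p) \<ge>
      cost p + max_weight a b (tail G (p ! i)) (tail G (p ! j)) + 1
    \<or> cost (take j p) - cost (take i p) \<le> - max_weight a b (tail G (p ! j)) (tail G (p ! i)) - 1"
proof -
  interpret wf_digraph G using valid by (simp add: valid_weighted_digraph_def)
  let ?u = "tail G (p ! i)" and ?v = "tail G (p ! j)"
  have cyc: "cycle p" and asc: "cost p \<ge> 0"
    using p by (auto simp: m_ascending_cycle_def cost_def)
  have V: "verts G = {1..n}" using valid by (simp add: valid_weighted_digraph_def)
  have "distinct (map (tail G) p)" "set p \<subseteq> arcs G"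
    using cyc by (auto simp: cycle_iff_distinct_tails)
  then have uv: "?u \<in> {1..n}" "?v \<in> {1..n}" "?u \<noteq> ?v"
    using ij V[symmetric] by (auto simp: distinct_conv_nth intro!: tail_in_verts)
  have "p = take j p @ drop j p" by simp
  then have "cost p = cost (take j p) + cost (drop j p)"
    unfolding cost_def by (metis awalk_cost_append)
  moreover have "take j p = take i p @ drop i (take j p)"
    using ij append_take_drop_id[of i "take j p"] by simp
  then have "cost (take j p) = cost (take i p) + cost (drop i (take j p))"
    unfolding cost_def by (metis awalk_cost_append)
  ultimately have cost_split:
    "cost (drop i (take j p)) = cost (take j p) - cost (take i p)"
    "cost (drop j p) = cost p - cost (take j p)"
    by simp_all
  have short: "cost (take i p) + weight e + cost (drop j p) \<le> -1"
    if "e \<in> arcs G" "tail G e = ?u" "head G e = ?v" for e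
  proof -
    let ?q = "take i p @ e # drop j p"
    have "cycle ?q" using cycle_shortcut[OF cyc _ ij(2) that] ij by simp
    moreover have "\<not> m_ascending_cycle G weight ?q" using minimal[of ?q] ij by auto
    ultimately have "awalk_cost weight ?q \<le> -1"
      using cycle_cost_le_minus_one[OF ab valid, of ?q] ij by simp
    then show ?thesis by (simp add: cost_def)
  qed
  have backward: "cost (drop i (take j p)) + weight f \<le> -1"
    if "f \<in> arcs G" "tail G f = ?v" "head G f = ?u" for f
  proof -
    let ?q = "drop i (take j p) @ [f]"
    have "cycle ?q" using cycle_close_back[OF cyc _ ij(2) that] ij by simp
    moreover have "\<not> m_ascending_cycle G weight ?q" using minimal[of ?q] ij by auto
    ultimately have "awalk_cost weight ?q \<le> -1"
      using cycle_cost_le_minus_one[OF ab valid, of ?q] ij by simp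
    then show ?thesis by (simp add: cost_def)
  qed
  from valid uv show ?thesis
  proof (cases rule: valid_edge_cases)
    case (mutual e f)
    then show ?thesis using short[of e] backward[of f] cost_split asc by simp
  next
    case (direct e)
    then show ?thesis using short[of e] cost_split by simp
  next
    case (reverse f)
    then show ?thesis using backward[of f] cost_split by simp
  qed
qed

lemma shortest_ascending_cycle_length:
  assumes ab: "a + b \<ge> 2" "a \<ge> 0" "b \<ge> 0"
    and valid: "valid_weighted_digraph a b n G weight"
    and p: "m_ascending_cycle G weight p"
    and minimal: "\<And>q. m_ascending_cycle G weight q \<Longrightarrow> length p \<le> length q"
  shows "length p \<le> 4"
proof (rule ccontr)
  assume "\<not> length p \<le> 4"
  then have k: "length p \<ge> 5" by simp
  interpret wf_digraph G using valid by (simp add: valid_weighted_digraph_def)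
  have cyc: "cycle p" and asc: "awalk_cost weight p \<ge> 0"
    using p by (auto simp: m_ascending_cycle_def)
  have d: "distinct (map (tail G) p)"
    using cyc by (simp add: cycle_iff_distinct_tails)
  define D where "D i j = max_weight a b (tail G (p ! i)) (tail G (p ! j))" for i j
  define P where "P i = awalk_cost weight (take i p)" for i
  have P_Suc: "P (Suc i) - P i = weight (p ! i)" if "i < length p" for i
    using that by (simp add: P_def take_Suc_conv_app_nth)
  have bounds: "- max_weight a b (head G (p ! i)) (tail G (p ! i)) \<le> weight (p ! i)"
    "weight (p ! i) \<le> max_weight a b (tail G (p ! i)) (head G (p ! i))" if "i < length p" for i
    using valid_weight_bounds[OF ab(1) valid cycle_arc_not_loop[OF wf_digraph_axioms cyc _ nth_mem[OF that]]]
      k by simp_all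
  have last: "awalk_cost weight p - P (length p - 1) = weight (p ! (length p - 1))"
    using P_Suc[of "length p - 1"] k by (simp add: P_def)
  show False
  proof (rule no_cycle_with_oriented_chords[OF k asc, of P D])
    show "P 0 = 0" by (simp add: P_def)
    show "D i l \<le> D i j + D j l + 1"
      if "i < length p" "j < length p" "l < length p" "i \<noteq> j" "j \<noteq> l" for i j l
      unfolding D_def using that d ab by (intro max_weight_triangle) (auto simp: distinct_conv_nth)
    show "- D (Suc i) i \<le> P (Suc i) - P i \<and> P (Suc i) - P i \<le> D i (Suc i)"
      if "Suc i < length p" for i
      using bounds[of i] P_Suc[of i] cycle_step[OF cyc that] that by (simp add: D_def)
    show "- D 0 (length p - 1) \<le> awalk_cost weight p - P (length p - 1)"
      "awalk_cost weight p - P (length p - 1) \<le> D (length p - 1) 0"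
      using bounds[of "length p - 1"] last cycle_last_step[OF cyc] k by (simp_all add: D_def)
    show "P j - P i \<ge> awalk_cost weight p + D i j + 1 \<or> P j - P i \<le> - D j i - 1"
      if "i + 2 \<le> j" "j < length p" "j - i < length p - 1" for i j
      unfolding P_def D_def using chord_dichotomy[OF ab(1) valid p minimal that] by simp
  qed
qed

section \<open>Short cycles decide acyclicity\<close>

theorem theorem5p5:
  fixes a b :: int and n :: nat
    and G :: "(nat, 'e) pre_digraph" and weight :: "'e weight_fun"
  assumes "a + b \<ge> 2"
    and "a \<ge> 0" and "b \<ge> 0"
    and "valid_weighted_digraph a b n G weight"
  shows "m_acyclic G weight \<longleftrightarrow>
           \<not> (\<exists>p. m_ascending_cycle G weight p \<and> length p \<le> 4)"
proof -
  have "\<exists>q. m_ascending_cycle G weight q \<and> length q \<le> 4" if p: "m_ascending_cycle G weight p" for p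
  proof -
    obtain q where "m_ascending_cycle G weight q"
      and "\<And>r. m_ascending_cycle G weight r \<Longrightarrow> length q \<le> length r"
      using p ex_has_least_nat[of "m_ascending_cycle G weight" p length] by blast
    then show ?thesis using shortest_ascending_cycle_length[OF assms] by blast
  qed
  then show ?thesis unfolding m_acyclic_def by blast
qed

end
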